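(* Let $k\ge2$ and $b\ge2$ be integers and let $K$ be the set of numbers in $[0,1]$ having a base-$b$ expansion using only the digits $0$ and $1$. Assume $\Psi:\mathbb{N}\to\mathbb{R}_{>0}$ satisfies $\Psi(x)<\frac12x^{-1}$ for all sufficiently large $x$ and $\Psi(lx)\le l\Psi(x)$ for all $l,x\in\mathbb{N}$. Then for any $c<1/b$ the set $$\big(\mathscr{K}_k(\Psi)\setminus\mathscr{K}_k(c\Psi)\big)\cap K$$ is uncountable. The same holds with $\mathscr{K}_k$ replaced by $\mathscr{K}_k^{\ast}$, and then the condition $\Psi(lx)\le l\Psi(x)$ may be dropped.
   Context: $\mathbb{N}=\{1,2,\dots\}$; $\mathscr{C}_k$ = reals not algebraic of degree $\le k$; $\mathscr{K}_k(\Psi)=\{\zeta\in\mathscr{C}_k:\max_{1\le j\le k}|\zeta^jq-p_j|\le\Psi(q)$ for infinitely many $(q,p_1,\dots,p_k)\in\mathbb{N}\times\mathbb{Z}^k\}$, and $\mathscr{K}_k^{\ast}(\Psi)$ is the same counting only vectors with $\gcd(q,p_1,\dots,p_k)=1$. *)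

theory Defs
  imports Complex_Main "HOL-Computational_Algebra.Polynomial" "HOL-Library.FuncSet"
    "HOL-Library.Countable_Set"
begin

text \<open>Degree over the rationals; only meaningful when \<^term>\<open>algebraic x\<close> holds.\<close>

definition algebraic_degree :: "real \<Rightarrow> nat" where
  "algebraic_degree x =
     (LEAST d. \<exists>p. (\<forall>i. coeff p i \<in> \<rat>) \<and> p \<noteq> 0 \<and> poly p x = 0 \<and> degree p = d)"

definition non_algebraic :: "nat \<Rightarrow> real set" where
  "non_algebraic k = {\<zeta>. \<not> (algebraic \<zeta> \<and> algebraic_degree \<zeta> \<le> k)}"

text \<open>A vector of $k$ integers is an extensional function on \<^term>\<open>{1..k}\<close>, so that distinct
  functions are distinct vectors and infinitely many vectors can be expressed by \<^const>\<open>infinite\<close>.\<close>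

definition approx_vectors :: "nat \<Rightarrow> (nat \<Rightarrow> real) \<Rightarrow> real \<Rightarrow> (nat \<times> (nat \<Rightarrow> int)) set" where
  "approx_vectors k \<Psi> \<zeta> =
     {(q, p). q \<ge> 1 \<and> p \<in> {1..k} \<rightarrow>\<^sub>E UNIV \<and>
        (MAX j\<in>{1..k}. \<bar>\<zeta> ^ j * real q - real_of_int (p j)\<bar>) \<le> \<Psi> q}"

definition primitive_vectors :: "nat \<Rightarrow> (nat \<times> (nat \<Rightarrow> int)) set" where
  "primitive_vectors k = {(q, p). Gcd (insert (int q) (p ` {1..k})) = 1}"

definition approximable :: "nat \<Rightarrow> (nat \<Rightarrow> real) \<Rightarrow> real set" where
  "approximable k \<Psi> = {\<zeta> \<in> non_algebraic k. infinite (approx_vectors k \<Psi> \<zeta>)}"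

definition approximable_prim :: "nat \<Rightarrow> (nat \<Rightarrow> real) \<Rightarrow> real set" where
  "approximable_prim k \<Psi> =
     {\<zeta> \<in> non_algebraic k. infinite (approx_vectors k \<Psi> \<zeta> \<inter> primitive_vectors k)}"

definition digits01_set :: "nat \<Rightarrow> real set" where
  "digits01_set b =
     {x \<in> {0..1}. \<exists>d :: nat \<Rightarrow> nat. (\<forall>i. d i \<in> {0, 1}) \<and> (\<lambda>i. real (d i) / real b ^ Suc i) sums x}"

end

theory Submission
  imports Defs
begin

text \<open>
  The number \<open>\<zeta> = \<Sum> b\<^bsup>-a n\<^esup>\<close> has rapidly growing exponents: with \<open>z n\<close> the partial sum of
  denominator \<open>b\<^bsup>a n\<^esup>\<close> and \<open>Q = b\<^bsup>k a n\<^esup>\<close>, the next digit is placed at the first position for which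
  \<open>Q (\<zeta> - z n) \<le> \<Psi> Q\<close>; one position earlier this fails, so \<open>Q (\<zeta> - z n) > c \<Psi> Q\<close> for \<open>c < 1 / b\<close>.
  As \<open>\<zeta> \<le> 1 / 2\<close>, the first coordinate carries the maximum over the powers of \<open>\<zeta>\<close>.  Conversely, since
  \<open>\<Psi> q < 1 / (2 q)\<close>, a vector of quality \<open>c \<Psi>\<close> lies on the Veronese curve, so its \<open>q\<close> is divisible
  by the \<open>k\<close>-th power of the denominator of \<open>p 1 / q\<close>; this fraction is then so close to \<open>\<zeta>\<close> that it
  equals some \<open>z n\<close>, and the vector is a multiple of the one already excluded.
\<close>

section \<open>Finiteness of approximation vectors and comparison of errors\<close>

lemma mem_approx_vectors_iff:
  assumes "k \<ge> 1"
  shows "(q, p) \<in> approx_vectors k \<Psi> \<zeta> \<longleftrightarrow>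
    q \<ge> 1 \<and> p \<in> {1..k} \<rightarrow>\<^sub>E UNIV \<and> (\<forall>j\<in>{1..k}. \<bar>\<zeta> ^ j * real q - real_of_int (p j)\<bar> \<le> \<Psi> q)"
  using assms unfolding approx_vectors_def by (simp add: Max_le_iff)

text \<open>For fixed \<open>q\<close> each coordinate lies in a bounded interval of integers, so
  only large \<open>q\<close> decide whether there are infinitely many approximation
  vectors.\<close>

lemma finite_approx_vectors_le:
  assumes "k \<ge> 1"
  shows "finite {(q, p) \<in> approx_vectors k \<Psi> \<zeta>. q \<le> N}"
proof -
  define I where "I q j = {\<lceil>\<zeta> ^ j * real q - \<Psi> q\<rceil>..\<lfloor>\<zeta> ^ j * real q + \<Psi> q\<rfloor>}" for q j
  have "{(q, p) \<in> approx_vectors k \<Psi> \<zeta>. q \<le> N} \<subseteq> (SIGMA q:{..N}. Pi\<^sub>E {1..k} (I q))"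
  proof (rule subrelI)
    fix q p
    assume "(q, p) \<in> {(q, p) \<in> approx_vectors k \<Psi> \<zeta>. q \<le> N}"
    then have qp: "(q, p) \<in> approx_vectors k \<Psi> \<zeta>" "q \<le> N" by auto
    have "p j \<in> I q j" if "j \<in> {1..k}" for j
    proof -
      have "\<bar>\<zeta> ^ j * real q - real_of_int (p j)\<bar> \<le> \<Psi> q"
        using qp that mem_approx_vectors_iff[OF assms] by blast
      then show ?thesis
        unfolding I_def by (auto simp: ceiling_le_iff le_floor_iff abs_le_iff)
    qed
    moreover have "p \<in> {1..k} \<rightarrow>\<^sub>E UNIV"
      using qp mem_approx_vectors_iff[OF assms] by blast
    ultimately show "(q, p) \<in> (SIGMA q:{..N}. Pi\<^sub>E {1..k} (I q))"
      using qp(2) by (auto simp: PiE_iff)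
  qed
  moreover have "finite (SIGMA q:{..N}. Pi\<^sub>E {1..k} (I q))"
    by (intro finite_SigmaI finite_PiE) (auto simp: I_def)
  ultimately show ?thesis
    by (rule finite_subset)
qed

text \<open>The comparison can fail only for \<open>q \<le> N\<close>, which costs finitely many
  vectors. The set \<open>B\<close> allows all vectors and primitive vectors to be treated at
  once.\<close>

lemma infinite_approx_vectors_eventually_le:
  assumes "k \<ge> 1" and ev: "\<forall>\<^sub>F x in sequentially. \<Phi> x \<le> \<Psi> x"
    and inf: "infinite (approx_vectors k \<Phi> \<zeta> \<inter> B)"
  shows "infinite (approx_vectors k \<Psi> \<zeta> \<inter> B)"
proof
  assume fin: "finite (approx_vectors k \<Psi> \<zeta> \<inter> B)"
  obtain N where N: "\<Phi> x \<le> \<Psi> x" if "x \<ge> N" for x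
    using ev unfolding eventually_sequentially by blast
  have "approx_vectors k \<Phi> \<zeta> \<inter> B \<subseteq>
      {(q, p) \<in> approx_vectors k \<Phi> \<zeta>. q \<le> N} \<union> (approx_vectors k \<Psi> \<zeta> \<inter> B)"
  proof (clarify)
    fix q p
    assume qp: "(q, p) \<in> approx_vectors k \<Phi> \<zeta>" "(q, p) \<notin> approx_vectors k \<Psi> \<zeta>"
    show "q \<le> N"
    proof (rule ccontr)
      assume "\<not> q \<le> N"
      then have "\<Phi> q \<le> \<Psi> q" using N by simp
      with qp show False
        unfolding mem_approx_vectors_iff[OF assms(1)] by (meson order_trans)
    qed
  qed
  then show False
    using inf fin finite_approx_vectors_le[OF assms(1)] finite_subset by blast
qed

text \<open>In \<open>x ^ Suc j - y ^ Suc j = x * (x ^ j - y ^ j) + y ^ j * (x - y)\<close> both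
  \<open>x\<close> and, for \<open>j > 0\<close>, \<open>y ^ j\<close> are at most
  \<open>1 / 2\<close>, so each summand takes at most half of \<open>x - y\<close>.\<close>

lemma power_diff_le_diff:
  fixes x y :: real
  assumes "0 \<le> y" "y \<le> x" "x \<le> 1 / 2"
  shows "x ^ j - y ^ j \<le> x - y"
proof (induction j)
  case 0
  then show ?case using assms by simp
next
  case (Suc j)
  show ?case
  proof (cases "j = 0")
    case False
    have "y ^ j \<le> y ^ 1"
      using False assms by (intro power_decreasing) auto
    then have yj: "y ^ j \<le> 1 / 2" using assms by simp
    have "x * (x ^ j - y ^ j) \<le> 1 / 2 * (x - y)"
      using Suc assms by (intro mult_mono) (auto intro: power_mono)
    moreover have "y ^ j * (x - y) \<le> 1 / 2 * (x - y)"
      using yj assms by (intro mult_right_mono) auto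
    ultimately have "x * (x ^ j - y ^ j) + y ^ j * (x - y) \<le> x - y"
      using add_mono by fastforce
    moreover have "x ^ Suc j - y ^ Suc j = x * (x ^ j - y ^ j) + y ^ j * (x - y)"
      by (simp add: algebra_simps)
    ultimately show ?thesis by (simp only:)
  qed auto
qed

section \<open>A criterion for not being algebraic of degree at most \<open>k\<close>\<close>

lemma common_denominator:
  fixes f :: "nat \<Rightarrow> real"
  assumes "finite I" "\<forall>i\<in>I. f i \<in> \<rat>"
  shows "\<exists>D::int. D > 0 \<and> (\<forall>i\<in>I. of_int D * f i \<in> \<int>)"
  using assms
proof (induction I rule: finite_induct)
  case empty
  then show ?case by (intro exI[of _ 1]) auto
next
  case (insert i I)
  then obtain D :: int where D: "D > 0" "\<forall>i\<in>I. of_int D * f i \<in> \<int>" by auto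
  obtain u v :: int where uv: "v > 0" "f i = of_int u / of_int v"
    using insert.prems by (metis Rats_cases' insertI1)
  have "of_int (D * v) * f j \<in> \<int>" if "j \<in> insert i I" for j
  proof (cases "j = i")
    case True
    then have "of_int (D * v) * f j = of_int (D * u)" using uv by simp
    then show ?thesis by (metis Ints_of_int)
  next
    case False
    then have "of_int v * (of_int D * f j) \<in> \<int>" using D that by auto
    then show ?thesis by (simp add: mult_ac)
  qed
  then show ?case using D uv by (intro exI[of _ "D * v"]) auto
qed

text \<open>An integer relation of degree at most \<open>k\<close>, evaluated along good approximations of
  \<open>(1, \<zeta>, \<dots>, \<zeta>\<^sup>k)\<close>, is an integer of absolute value below \<open>1\<close>; so every \<open>z n\<close> far out is a root of it.\<close>

lemma non_algebraicI:
  fixes z \<delta> :: "nat \<Rightarrow> real" and Q :: "nat \<Rightarrow> nat"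
  assumes z: "inj z" and Q: "\<And>n. Q n > 0" and \<delta>: "\<delta> \<longlonglongrightarrow> 0"
    and int: "\<And>n j. j \<le> k \<Longrightarrow> real (Q n) * z n ^ j \<in> \<int>"
    and approx: "\<And>n j. j \<le> k \<Longrightarrow> \<bar>\<zeta> ^ j * real (Q n) - real (Q n) * z n ^ j\<bar> \<le> \<delta> n"
  shows "\<zeta> \<in> non_algebraic k"
proof (rule ccontr)
  assume "\<zeta> \<notin> non_algebraic k"
  then have alg: "algebraic \<zeta>" and deg: "algebraic_degree \<zeta> \<le> k"
    unfolding non_algebraic_def by auto
  let ?P = "\<lambda>d. \<exists>p. (\<forall>i. coeff p i \<in> \<rat>) \<and> p \<noteq> 0 \<and> poly p \<zeta> = 0 \<and> degree p = d"
  have "\<exists>d. ?P d" using alg unfolding algebraic_altdef by blast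
  then have "?P (algebraic_degree \<zeta>)" unfolding algebraic_degree_def by (rule LeastI_ex)
  then obtain p where p: "\<forall>i. coeff p i \<in> \<rat>" "p \<noteq> 0" "poly p \<zeta> = 0" "degree p \<le> k"
    using deg by metis
  obtain D :: int where D: "D > 0" "\<forall>i\<in>{..degree p}. of_int D * coeff p i \<in> \<int>"
    using common_denominator[of "{..degree p}" "coeff p"] p by auto
  define w where "w i = of_int D * coeff p i" for i
  define C where "C = (\<Sum>i\<le>degree p. \<bar>w i\<bar>)"
  have small: "\<bar>(\<Sum>i\<le>degree p. w i * (real (Q n) * z n ^ i))\<bar> \<le> C * \<delta> n" for n
  proof -
    \<comment> \<open>Subtracting the relation \<open>poly p \<zeta> = 0\<close>, multiplied by
      \<open>D * Q n\<close>, leaves only the approximation errors in the sum.\<close>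
    have "(\<Sum>i\<le>degree p. w i * (\<zeta> ^ i * real (Q n))) = of_int D * real (Q n) * poly p \<zeta>"
      unfolding poly_altdef w_def by (simp add: sum_distrib_left mult_ac)
    then have "(\<Sum>i\<le>degree p. w i * (\<zeta> ^ i * real (Q n))) = 0" using p by simp
    then have "\<bar>(\<Sum>i\<le>degree p. w i * (real (Q n) * z n ^ i))\<bar>
        = \<bar>\<Sum>i\<le>degree p. w i * (\<zeta> ^ i * real (Q n) - real (Q n) * z n ^ i)\<bar>"
      by (simp add: right_diff_distrib sum_subtractf)
    also have "\<dots> \<le> (\<Sum>i\<le>degree p. \<bar>w i\<bar> * \<delta> n)"
      using approx p(4) by (intro order.trans[OF sum_abs] sum_mono)
        (auto simp: abs_mult intro!: mult_left_mono)
    finally show ?thesis by (simp add: C_def sum_distrib_right)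
  qed
  have "(\<lambda>n. C * \<delta> n) \<longlonglongrightarrow> 0" using tendsto_mult_right_zero[OF \<delta>] .
  then have "\<forall>\<^sub>F n in sequentially. C * \<delta> n < 1" by (rule order_tendstoD) simp
  then obtain N where N: "\<And>n. n \<ge> N \<Longrightarrow> C * \<delta> n < 1" unfolding eventually_sequentially by blast
  have root: "poly p (z n) = 0" if "n \<ge> N" for n
  proof -
    let ?s = "\<Sum>i\<le>degree p. w i * (real (Q n) * z n ^ i)"
    have "?s \<in> \<int>"
    proof (intro Ints_sum)
      fix i assume "i \<in> {..degree p}"
      then have "w i \<in> \<int>" "real (Q n) * z n ^ i \<in> \<int>" using int p(4) D by (auto simp: w_def)
      then show "w i * (real (Q n) * z n ^ i) \<in> \<int>" by (rule Ints_mult)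
    qed
    moreover have "\<bar>?s\<bar> < 1" using small[of n] N[OF that] by linarith
    ultimately have "?s = 0" using Ints_nonzero_abs_less1 by blast
    moreover have "?s = of_int D * real (Q n) * poly p (z n)"
      unfolding poly_altdef w_def by (simp add: sum_distrib_left mult_ac)
    ultimately show ?thesis using D Q[of n] by simp
  qed
  have "z ` {N..} \<subseteq> {x. poly p x = 0}" using root by auto
  then have "finite (z ` {N..})" using poly_roots_finite[OF p(2)] finite_subset by blast
  then show False using z by (simp add: finite_image_iff inj_on_subset infinite_Ici)
qed

section \<open>Integer vectors close to the Veronese curve\<close>

text \<open>Good approximations of \<open>(\<zeta>, \<dots>, \<zeta>\<^sup>k)\<close> lie on the Veronese curve: \<open>p (j+1) / q\<close> and
  \<open>p j / q \<cdot> r / s\<close> differ by a fraction with denominator \<open>q s\<close> that is too small to be nonzero.\<close>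

lemma approx_on_veronese_curve:
  fixes \<zeta> \<eta> :: real and q k :: nat and p :: "nat \<Rightarrow> int"
  assumes "0 \<le> \<zeta>" "\<zeta> \<le> 1 / 2" "q \<ge> 1" "k \<ge> 1" and \<eta>: "\<eta> \<le> 1 / (4 * real q)"
    and approx: "\<And>j. j \<in> {1..k} \<Longrightarrow> \<bar>\<zeta> ^ j * real q - real_of_int (p j)\<bar> \<le> \<eta>"
  obtains s :: nat and r :: int and t :: nat where "s \<ge> 1" "coprime r (int s)" "q = s ^ k * t"
    "\<And>j. j \<in> {1..k} \<Longrightarrow> p j = int t * int s ^ (k - j) * r ^ j"
proof -
  \<comment> \<open>\<open>r / s\<close> is \<open>p 1 / q\<close> in lowest terms.\<close>
  define g where "g = gcd (p 1) (int q)"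
  define r where "r = p 1 div g"
  define s where "s = nat (int q div g)"
  have g: "g > 0" using assms unfolding g_def by (simp add: gcd_pos_int)
  have gq: "g dvd int q" "g dvd p 1" unfolding g_def by auto
  have s_int: "int s = int q div g"
    using g by (simp add: s_def pos_imp_zdiv_nonneg_iff)
  have q_eq: "int q = g * int s" and p_eq: "p 1 = g * r"
    using gq by (simp_all add: s_int r_def)
  have s: "s \<ge> 1" using q_eq assms(3) by (cases s) auto
  have cop: "coprime r (int s)"
    unfolding r_def s_int g_def using assms by (intro div_gcd_coprime) auto
  have "1 * int s \<le> g * int s" using g by (intro mult_right_mono) auto
  then have sq: "s \<le> q" using q_eq by simp
  have "0 \<le> \<bar>\<zeta> ^ 1 * real q - real_of_int (p 1)\<bar>" by simp
  also have "\<dots> \<le> \<eta>" using assms(4) by (intro approx) auto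
  finally have \<eta>0: "0 \<le> \<eta>" .
  have p1: "real_of_int (p 1) * real s = real q * real_of_int r"
  proof -
    have "p 1 * int s = int q * r" using q_eq p_eq by simp
    then have "real_of_int (p 1 * int s) = real_of_int (int q * r)" by presburger
    then show ?thesis by simp
  qed
  have step: "p (Suc j) * int s = p j * r" if j: "1 \<le> j" "Suc j \<le> k" for j
  proof -
    have a1: "\<bar>\<zeta> ^ Suc j * real q - real_of_int (p (Suc j))\<bar> \<le> \<eta>"
      using j by (intro approx) auto
    have a2: "\<bar>\<zeta> ^ j * real q - real_of_int (p j)\<bar> \<le> \<eta>" using approx j by auto
    have a3: "\<bar>\<zeta> * real q - real_of_int (p 1)\<bar> \<le> \<eta>"
      using approx[of 1] j by simp
    have q4: "\<eta> \<le> real q / 4"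
    proof -
      have "1 / (4 * real q) \<le> real q / 4"
        using assms(3) mult_mono[of 1 "real q" 1 "real q"] by (simp add: field_simps)
      then show ?thesis using \<eta> by linarith
    qed
    have "\<zeta> ^ j \<le> \<zeta> ^ 1" using j assms by (intro power_decreasing) auto
    then have "\<zeta> ^ j * real q \<le> 1 / 2 * real q" using assms by (intro mult_right_mono) auto
    moreover have "0 \<le> \<zeta> ^ j * real q" using assms by simp
    ultimately have pj: "\<bar>real_of_int (p j)\<bar> \<le> 3 / 4 * real q" using a2 q4 by linarith
    \<comment> \<open>The determinant \<open>q * p (Suc j) - p j * p 1\<close> would vanish for
      exact powers of \<open>\<zeta>\<close>, so it can be written in terms of the three
      errors.\<close>
    have "real q * real_of_int (p (Suc j) * int s - p j * r)
      = real s * (real q * real_of_int (p (Suc j)) - real_of_int (p j) * real_of_int (p 1))"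
      using p1 by (simp add: algebra_simps)
    also have "real q * real_of_int (p (Suc j)) - real_of_int (p j) * real_of_int (p 1)
      = - (real q * (\<zeta> ^ Suc j * real q - real_of_int (p (Suc j))))
        + \<zeta> * real q * (\<zeta> ^ j * real q - real_of_int (p j))
        + real_of_int (p j) * (\<zeta> * real q - real_of_int (p 1))"
      by (simp add: algebra_simps)
    finally have eq: "real q * real_of_int (p (Suc j) * int s - p j * r) = real s *
       (- (real q * (\<zeta> ^ Suc j * real q - real_of_int (p (Suc j))))
        + \<zeta> * real q * (\<zeta> ^ j * real q - real_of_int (p j))
        + real_of_int (p j) * (\<zeta> * real q - real_of_int (p 1)))" .
    have b1: "\<bar>real q * (\<zeta> ^ Suc j * real q - real_of_int (p (Suc j)))\<bar> \<le> real q * \<eta>"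
      using a1 by (simp add: abs_mult mult_left_mono)
    have b2: "\<bar>\<zeta> * real q * (\<zeta> ^ j * real q - real_of_int (p j))\<bar> \<le> (1/2 * real q) * \<eta>"
      unfolding abs_mult using a2 assms by (intro mult_mono) auto
    have b3: "\<bar>real_of_int (p j) * (\<zeta> * real q - real_of_int (p 1))\<bar> \<le> (3 / 4 * real q) * \<eta>"
      unfolding abs_mult using a3 pj by (intro mult_mono) auto
    \<comment> \<open>The weights \<open>1\<close>, \<open>1 / 2\<close> and \<open>3 / 4\<close>
      add up to \<open>9 / 4\<close>, and \<open>q * \<eta> \<le> 1 / 4\<close> keeps the total at
      \<open>9 / 16\<close>.\<close>
    have "\<bar>- (real q * (\<zeta> ^ Suc j * real q - real_of_int (p (Suc j))))
        + \<zeta> * real q * (\<zeta> ^ j * real q - real_of_int (p j))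
        + real_of_int (p j) * (\<zeta> * real q - real_of_int (p 1))\<bar> \<le> 9 / 4 * (real q * \<eta>)"
      using b1 b2 b3 by linarith
    also have "\<dots> \<le> 9 / 4 * (1 / 4)"
      using \<eta> assms(3) by (simp add: field_simps)
    also have "\<dots> < 1" by simp
    finally have lt1: "\<bar>- (real q * (\<zeta> ^ Suc j * real q - real_of_int (p (Suc j))))
        + \<zeta> * real q * (\<zeta> ^ j * real q - real_of_int (p j))
        + real_of_int (p j) * (\<zeta> * real q - real_of_int (p 1))\<bar> < 1" .
    \<comment> \<open>An integer whose product with \<open>q\<close> is below
      \<open>s \<le> q\<close> in absolute value must be zero.\<close>
    have "\<bar>real q * real_of_int (p (Suc j) * int s - p j * r)\<bar> < real s * 1"
      unfolding eq abs_mult[of "real s"] abs_of_nat using lt1 s by (intro mult_strict_left_mono) auto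
    then have "real q * \<bar>real_of_int (p (Suc j) * int s - p j * r)\<bar> < real q * 1"
      using sq unfolding abs_mult[of "real q"] abs_of_nat by linarith
    then have "\<bar>real_of_int (p (Suc j) * int s - p j * r)\<bar> < 1"
      using assms(3) by (simp only: mult_less_cancel_left_pos)
    then show ?thesis by linarith
  qed
  have curve: "p j * int s ^ j = int q * r ^ j" if "1 \<le> j" "j \<le> k" for j
    using that
  proof (induction j rule: dec_induct)
    case base
    then show ?case using q_eq p_eq by simp
  next
    case (step j)
    have "p (Suc j) * int s ^ Suc j = (p (Suc j) * int s) * int s ^ j" by (simp add: mult_ac)
    also have "\<dots> = r * (p j * int s ^ j)" using \<open>1 \<le> j\<close> step(4) assms
      by (simp add: \<open>\<And>j. 1 \<le> j \<Longrightarrow> Suc j \<le> k \<Longrightarrow> p (Suc j) * int s = p j * r\<close>)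
    also have "\<dots> = r * (int q * r ^ j)" using step by simp
    finally show ?case by (simp add: mult_ac)
  qed
  \<comment> \<open>At \<open>j = k\<close> the relation \<open>curve\<close> forces
    \<open>s ^ k\<close> into \<open>q\<close>, because \<open>r ^ k\<close> is coprime to
    it.\<close>
  have "int s ^ k dvd int q * r ^ k"
    using curve[of k] assms(4) by (metis dvd_triv_right order_refl)
  moreover have "coprime (int s ^ k) (r ^ k)" using cop by (simp add: coprime_commute)
  ultimately have "int (s ^ k) dvd int q" by (simp add: coprime_dvd_mult_left_iff)
  then obtain t where t: "q = s ^ k * t" unfolding int_dvd_int_iff by (elim dvdE)
  have "p j = int t * int s ^ (k - j) * r ^ j" if j: "j \<in> {1..k}" for j
  proof -
    have "int s ^ k = int s ^ (k - j) * int s ^ j" using j by (simp flip: power_add)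
    then have "p j * int s ^ j = (int t * int s ^ (k - j) * r ^ j) * int s ^ j"
      using curve[of j] j by (simp add: t mult_ac)
    moreover have "int s ^ j \<noteq> 0" using s by simp
    ultimately show ?thesis using mult_right_cancel by blast
  qed
  then show thesis using that s cop t by blast
qed

section \<open>The number with sparse digits coded by a set \<open>S\<close>\<close>

text \<open>\<open>\<phi>\<close> stands for a truncation of the given function, and
  \<open>\<epsilon>\<close> measures the room for all digits after the next one. The bounds on
  \<open>\<phi> 1\<close> make \<open>b ^ a 1\<close> at least \<open>64\<close> and at least
  \<open>2 / \<epsilon>\<close>.\<close>

locale digit_construction =
  fixes k b :: nat and \<phi> :: "nat \<Rightarrow> real" and \<epsilon> :: real and S :: "nat set"
  assumes k: "k \<ge> 2" and b: "b \<ge> 2"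
    and \<phi>_pos: "\<And>x. x \<ge> 1 \<Longrightarrow> \<phi> x > 0"
    and \<phi>_le: "\<And>x. x \<ge> 1 \<Longrightarrow> \<phi> x \<le> 1 / (2 * real x)"
    and \<epsilon>: "0 < \<epsilon>" "\<epsilon> < 1"
    and \<phi>_1: "\<phi> 1 \<le> 1 / 64" "\<phi> 1 \<le> \<epsilon> / 2"
begin

definition Q :: "nat \<Rightarrow> nat" where "Q e = b ^ (k * e)"

text \<open>The factor \<open>1 + \<epsilon>\<close> reserves space for the tail behind the new
  digit, so that a digit placed here keeps the whole error, not just its leading term, within
  \<open>\<phi> (Q e)\<close>.\<close>

definition next_pos :: "nat \<Rightarrow> nat" where
  "next_pos e = (LEAST A. (1 + \<epsilon>) * real (Q e) / real b ^ A \<le> \<phi> (Q e))"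

text \<open>At odd \<open>n\<close> the set \<open>S\<close> may move the next digit one place to the left, which keeps the
  lower bound on the error; the even \<open>n\<close> supply the approximations of quality \<open>\<phi>\<close>.\<close>

definition shift :: "nat \<Rightarrow> nat" where
  "shift n = (if odd n \<and> n div 2 \<in> S then 1 else 0)"

fun a :: "nat \<Rightarrow> nat" where
  "a 0 = 0"
| "a (Suc n) = next_pos (a n) - shift n"

definition z :: "nat \<Rightarrow> real" where "z n = (\<Sum>i<n. 1 / real b ^ a (Suc i))"

definition \<zeta> :: real where "\<zeta> = (\<Sum>i. 1 / real b ^ a (Suc i))"

fun num :: "nat \<Rightarrow> nat" where
  "num 0 = 0"
| "num (Suc n) = num n * b ^ (a (Suc n) - a n) + 1"

text \<open>Minimality of the position loses a factor \<open>b\<close>, the reserve for the tail a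
  factor \<open>1 + \<epsilon>\<close>; as \<open>\<epsilon>\<close> tends to \<open>0\<close> this
  approaches \<open>1 / b\<close>.\<close>

definition c :: real where "c = 1 / (real b * (1 + \<epsilon>))"

lemma Q_pos: "Q e \<ge> 1"
  using b by (simp add: Q_def)

lemma b_pos [simp]: "0 < b" "b \<noteq> 0"
  using b by auto

lemma b_pow_pos: "real b ^ n > 0"
  by simp

declare a.simps(2) [simp del]

lemma c_bounds: "0 < c" "c \<le> 1 / 2"
proof -
  show "0 < c" using b \<epsilon> by (simp add: c_def)
  have "2 * 1 \<le> real b * (1 + \<epsilon>)" using b \<epsilon> by (intro mult_mono) auto
  then show "c \<le> 1 / 2" unfolding c_def using frac_le[of 1 1 2 "real b * (1 + \<epsilon>)"] by simp
qed

lemma next_pos_upper: "(1 + \<epsilon>) * real (Q e) / real b ^ next_pos e \<le> \<phi> (Q e)"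
proof -
  have "(\<lambda>A. (1 + \<epsilon>) * real (Q e) / real b ^ A) \<longlonglongrightarrow> 0"
    using b by (intro LIMSEQ_divide_realpow_zero) auto
  then have "\<forall>\<^sub>F A in sequentially. (1 + \<epsilon>) * real (Q e) / real b ^ A < \<phi> (Q e)"
    using \<phi>_pos[OF Q_pos] by (rule order_tendstoD)
  then obtain A where "(1 + \<epsilon>) * real (Q e) / real b ^ A < \<phi> (Q e)"
    using eventually_happens by fastforce
  then have "(1 + \<epsilon>) * real (Q e) / real b ^ A \<le> \<phi> (Q e)" by (rule less_imp_le)
  then show ?thesis
    unfolding next_pos_def by (rule LeastI)
qed

text \<open>The choice of position and \<open>\<phi> x \<le> 1 / (2 * x)\<close> force
  \<open>b ^ next_pos e\<close> above \<open>2 * Q e ^ 2\<close>; since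
  \<open>Q e = b ^ (k * e)\<close>, \<open>k \<ge> 2\<close> yields the exponent
  \<open>4 * e\<close>.\<close>

lemma next_pos_growth: "2 * real b ^ (4 * e) < real b ^ next_pos e"
proof -
  let ?q = "real (Q e)" and ?B = "real b ^ next_pos e"
  have q: "?q \<ge> 1" using Q_pos[of e] by simp
  have "(1 + \<epsilon>) * ?q / ?B \<le> 1 / (2 * ?q)"
    using next_pos_upper \<phi>_le[OF Q_pos] by (rule order_trans)
  then have "2 * ?q * ((1 + \<epsilon>) * ?q) \<le> ?B"
    using q b_pow_pos by (simp add: field_simps)
  moreover have "2 * ?q * (1 * ?q) < 2 * ?q * ((1 + \<epsilon>) * ?q)"
    using q \<epsilon> by (intro mult_strict_left_mono mult_strict_right_mono) auto
  moreover have "real b ^ (4 * e) \<le> ?q * ?q"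
  proof -
    have "real b ^ (4 * e) \<le> real b ^ (k * e + k * e)"
      using b mult_right_mono[OF k, of e] by (intro power_increasing) linarith+
    then show ?thesis by (simp add: Q_def power_add)
  qed
  ultimately show ?thesis by linarith
qed

lemma next_pos_ge_1: "next_pos e \<ge> 1"
proof (rule ccontr)
  assume "\<not> next_pos e \<ge> 1"
  then have "next_pos e = 0" by simp
  then have "2 * real b ^ (4 * e) < 1" using next_pos_growth[of e] by simp
  moreover have "1 \<le> real b ^ (4 * e)" using b by simp
  ultimately show False by linarith
qed

lemma next_pos_lower: "c * \<phi> (Q e) < real (Q e) / real b ^ next_pos e"
proof -
  obtain A where A: "next_pos e = Suc A" using next_pos_ge_1[of e] by (cases "next_pos e") auto
  have "\<not> (1 + \<epsilon>) * real (Q e) / real b ^ A \<le> \<phi> (Q e)"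
    using A unfolding next_pos_def by (intro not_less_Least) simp
  then have less: "\<phi> (Q e) < (1 + \<epsilon>) * real (Q e) / real b ^ A" by simp
  have "c * \<phi> (Q e) < c * ((1 + \<epsilon>) * real (Q e) / real b ^ A)"
    using less c_bounds by (intro mult_strict_left_mono) auto
  also have "\<dots> = real (Q e) / real b ^ next_pos e"
    using \<epsilon> by (simp add: A c_def)
  finally show ?thesis .
qed

lemma a_Suc_le: "a (Suc n) \<le> next_pos (a n)"
  by (simp add: a.simps)

lemma next_pos_le: "next_pos (a n) \<le> Suc (a (Suc n))"
  using next_pos_ge_1[of "a n"] by (simp add: shift_def a.simps)

text \<open>\<open>next_pos (a n)\<close> strictly exceeds \<open>4 * a n\<close>, and this
  strictness absorbs a possible shift by one place.\<close>

lemma a_growth: "4 * a n \<le> a (Suc n)"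
proof -
  have "1 * real b ^ (4 * a n) \<le> 2 * real b ^ (4 * a n)" by (intro mult_right_mono) auto
  then have "real b ^ (4 * a n) < real b ^ next_pos (a n)" using next_pos_growth[of "a n"] by linarith
  then have "4 * a n < next_pos (a n)" using b by simp
  then show ?thesis using next_pos_le[of n] by linarith
qed

lemma b_pow_a1: "1 / \<phi> 1 \<le> real b ^ a 1"
proof -
  \<comment> \<open>Index \<open>0\<close> is even, hence unshifted, and \<open>Q 0 = 1\<close>, so
    \<open>a 1\<close> is \<open>next_pos 0\<close>.\<close>
  have "(1 + \<epsilon>) / real b ^ a 1 \<le> \<phi> 1"
    using next_pos_upper[of 0] by (simp add: Q_def shift_def a.simps)
  then have "1 + \<epsilon> \<le> \<phi> 1 * real b ^ a 1" using b_pow_pos by (simp add: field_simps)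
  then have "1 \<le> \<phi> 1 * real b ^ a 1" using \<epsilon> by linarith
  then show ?thesis using \<phi>_pos[of 1] by (simp add: field_simps)
qed

lemma a_strict: "a n < a (Suc n)"
proof (induction n)
  case 0
  then show ?case using next_pos_ge_1[of 0] by (simp add: shift_def a.simps)
next
  case (Suc n)
  then show ?case using a_growth[of "Suc n"] by linarith
qed

lemma strict_mono_a: "strict_mono a"
  using a_strict by (rule strict_mono_Suc_iff[THEN iffD2, rule_format])

lemma b_pow_a_Suc_ge: "real b ^ a (Suc n) \<ge> 64" "real b ^ a (Suc n) \<ge> 2 / \<epsilon>"
proof -
  have "a 1 \<le> a (Suc n)" using strict_mono_a by (simp add: strict_mono_less_eq)
  then have "real b ^ a 1 \<le> real b ^ a (Suc n)" using b by (intro power_increasing) auto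
  then have *: "1 / \<phi> 1 \<le> real b ^ a (Suc n)" using b_pow_a1 by linarith
  have "64 \<le> 1 / \<phi> 1" "2 / \<epsilon> \<le> 1 / \<phi> 1"
    using \<phi>_pos[of 1] \<phi>_1 \<epsilon> by (simp_all add: field_simps)
  with * show "real b ^ a (Suc n) \<ge> 64" "real b ^ a (Suc n) \<ge> 2 / \<epsilon>" by linarith+
qed

text \<open>The digit at \<open>a (Suc n)\<close> uses up \<open>1\<close> of the
  \<open>1 + \<epsilon>\<close> units of \<open>1 / b ^ a (Suc n)\<close>; the later ones must fit
  into the remaining \<open>\<epsilon>\<close>. They do, as the denominator is at least squared and
  is at least \<open>2 / \<epsilon>\<close>.\<close>

lemma tail_step: "(1 + \<epsilon>) / real b ^ a (Suc (Suc n)) \<le> \<epsilon> / real b ^ a (Suc n)"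
proof -
  define B where "B = real b ^ a (Suc n)"
  have B: "B > 0" "2 / \<epsilon> \<le> B" unfolding B_def using b_pow_a_Suc_ge(2) by auto
  have "B * B = real b ^ (2 * a (Suc n))" by (simp add: B_def power_add mult_2)
  also have "\<dots> \<le> real b ^ a (Suc (Suc n))"
    using b a_growth[of "Suc n"] by (intro power_increasing) auto
  finally have "(1 + \<epsilon>) / real b ^ a (Suc (Suc n)) \<le> (1 + \<epsilon>) / (B * B)"
    using \<epsilon>(1) B(1) by (intro divide_left_mono mult_pos_pos b_pow_pos) simp_all
  also have "\<dots> \<le> \<epsilon> / B"
  proof -
    have "1 + \<epsilon> \<le> \<epsilon> * B" using B(2) \<epsilon> by (simp add: field_simps)
    then have "(1 + \<epsilon>) / (B * B) \<le> (\<epsilon> * B) / (B * B)"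
      using B(1) by (intro divide_right_mono) simp_all
    then show ?thesis using B(1) by simp
  qed
  finally show ?thesis unfolding B_def .
qed

section \<open>Partial sums and the size of the error\<close>

lemma z_Suc: "z (Suc n) = z n + 1 / real b ^ a (Suc n)"
  by (simp add: z_def)

lemma z_mono: "z n < z (Suc n)"
  using b_pow_pos[of "a (Suc n)"] by (simp add: z_Suc)

lemma strict_mono_z: "strict_mono z"
  using z_mono by (rule strict_mono_Suc_iff[THEN iffD2, rule_format])

lemma z_nonneg: "0 \<le> z n"
  unfolding z_def by (intro sum_nonneg) simp

text \<open>By \<open>tail_step\<close> the bounds on the right decrease in \<open>n\<close>, and
  each exceeds its own \<open>z n\<close>; both sides are compared at
  \<open>max m n\<close>.\<close>

lemma z_le: "z m \<le> z n + (1 + \<epsilon>) / real b ^ a (Suc n)"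
proof -
  let ?U = "\<lambda>n. z n + (1 + \<epsilon>) / real b ^ a (Suc n)"
  have "?U (Suc n) \<le> ?U n" for n
    using tail_step[of n] by (simp add: z_Suc add_divide_distrib)
  then have dec: "decseq ?U" by (rule decseq_SucI)
  have "z m \<le> z (max m n)" using strict_mono_z by (simp add: strict_mono_less_eq)
  also have "\<dots> \<le> ?U (max m n)" using \<epsilon>(1) by simp
  also have "\<dots> \<le> ?U n" using decseqD[OF dec, of n "max m n"] by simp
  finally show ?thesis .
qed

lemma summable_digits: "summable (\<lambda>i. 1 / real b ^ a (Suc i))"
proof (rule summableI_nonneg_bounded)
  show "(\<Sum>i<n. 1 / real b ^ a (Suc i)) \<le> z 0 + (1 + \<epsilon>) / real b ^ a (Suc 0)" for n
    using z_le[of n 0] unfolding z_def .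
qed simp

lemma error_lower: "1 / real b ^ a (Suc n) \<le> \<zeta> - z n"
proof -
  have "z (Suc n) \<le> \<zeta>"
    unfolding z_def \<zeta>_def by (rule sum_le_suminf[OF summable_digits]) auto
  then show ?thesis by (simp add: z_Suc)
qed

lemma error_upper: "\<zeta> - z n \<le> (1 + \<epsilon>) / real b ^ a (Suc n)"
proof -
  have "\<zeta> \<le> z n + (1 + \<epsilon>) / real b ^ a (Suc n)"
    unfolding \<zeta>_def by (rule suminf_le_const[OF summable_digits]) (fold z_def, rule z_le)
  then show ?thesis by simp
qed

lemma z_less_\<zeta>: "z n < \<zeta>"
proof -
  have "0 < 1 / real b ^ a (Suc n)" by simp
  then show ?thesis using error_lower[of n] by linarith
qed

lemma error_gt: "c * \<phi> (Q (a n)) < real (Q (a n)) * (\<zeta> - z n)"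
proof -
  have "c * \<phi> (Q (a n)) < real (Q (a n)) / real b ^ next_pos (a n)" by (rule next_pos_lower)
  also have "\<dots> \<le> real (Q (a n)) * (1 / real b ^ a (Suc n))"
  proof -
    have "real b ^ a (Suc n) \<le> real b ^ next_pos (a n)"
      using b a_Suc_le[of n] by (intro power_increasing) auto
    then have "1 / real b ^ next_pos (a n) \<le> 1 / real b ^ a (Suc n)"
      by (intro divide_left_mono mult_pos_pos b_pow_pos) auto
    then have "real (Q (a n)) * (1 / real b ^ next_pos (a n)) \<le> real (Q (a n)) * (1 / real b ^ a (Suc n))"
      by (rule mult_left_mono) simp
    then show ?thesis by simp
  qed
  also have "\<dots> \<le> real (Q (a n)) * (\<zeta> - z n)"
    using error_lower[of n] by (intro mult_left_mono) auto
  finally show ?thesis .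
qed

lemma error_le:
  assumes "shift n = 0"
  shows "real (Q (a n)) * (\<zeta> - z n) \<le> \<phi> (Q (a n))"
proof -
  have "real (Q (a n)) * (\<zeta> - z n) \<le> real (Q (a n)) * ((1 + \<epsilon>) / real b ^ a (Suc n))"
    using error_upper[of n] by (intro mult_left_mono) auto
  also have "\<dots> = (1 + \<epsilon>) * real (Q (a n)) / real b ^ next_pos (a n)"
    using assms by (simp add: a.simps)
  also have "\<dots> \<le> \<phi> (Q (a n))" by (rule next_pos_upper)
  finally show ?thesis .
qed

lemma \<zeta>_bounds: "0 < \<zeta>" "\<zeta> \<le> 1 / 2"
proof -
  show "0 < \<zeta>" using z_less_\<zeta>[of 0] by (simp add: z_def)
  \<comment> \<open>For \<open>n = 0\<close> the partial sum is \<open>0\<close> and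
    \<open>Q\<close> is \<open>1\<close>, so
    \<open>\<zeta> \<le> \<phi> 1 \<le> 1 / 64\<close>.\<close>
  show "\<zeta> \<le> 1 / 2" using error_le[of 0] \<phi>_1 by (simp add: z_def Q_def shift_def)
qed

section \<open>Numerators, digits, approximations of quality \<open>\<phi>\<close> and
  non-algebraicity\<close>

lemma z_eq: "z n = real (num n) / real b ^ a n"
proof (induction n)
  case 0
  then show ?case by (simp add: z_def)
next
  case (Suc n)
  have "real b ^ a (Suc n) = real b ^ (a (Suc n) - a n) * real b ^ a n"
    using a_strict[of n] by (simp flip: power_add)
  then show ?case
    using Suc by (simp add: z_Suc add_divide_distrib)
qed

text \<open>For \<open>n > 0\<close> the last digit makes \<open>num n\<close> congruent to
  \<open>1\<close> modulo \<open>b\<close>, as the exponents strictly increase; for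
  \<open>n = 0\<close> the denominator is \<open>1\<close>.\<close>

lemma coprime_num: "coprime (num n) (b ^ a n)"
proof (cases n)
  case (Suc m)
  obtain d where "a (Suc m) - a m = Suc d"
    using a_strict[of m] by (metis Suc_diff_Suc)
  then have "num n = b * (num m * b ^ d) + 1" using Suc by simp
  then have "coprime (num n) b" by (metis coprime_1_left coprime_iff_gcd_eq_1 gcd.commute gcd_add_mult mult.commute)
  then show ?thesis by simp
qed simp

lemma \<zeta>_in_digits01_set: "\<zeta> \<in> digits01_set b"
proof -
  define d :: "nat \<Rightarrow> nat" where "d i = (if Suc i \<in> range (\<lambda>n. a (Suc n)) then 1 else 0)" for i
  \<comment> \<open>Digit \<open>d i\<close> has weight \<open>1 / b ^ Suc i\<close>, hence the
    offset by one; \<open>a (Suc n)\<close> is positive, so the subtraction is not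
    truncated.\<close>
  define g where "g n = a (Suc n) - 1" for n
  have Suc_g: "Suc (g n) = a (Suc n)" for n using a_strict[of n] by (simp add: g_def)
  have "strict_mono g"
    unfolding strict_mono_Suc_iff using Suc_g a_strict by (metis Suc_less_eq)
  moreover have "real (d i) / real b ^ Suc i = 0" if "i \<notin> range g" for i
  proof -
    have "Suc i \<notin> range (\<lambda>n. a (Suc n))"
    proof
      assume "Suc i \<in> range (\<lambda>n. a (Suc n))"
      then obtain n where "Suc i = a (Suc n)" by blast
      then have "i = g n" using Suc_g[of n] by simp
      then show False using that by simp
    qed
    then show ?thesis by (simp add: d_def)
  qed
  ultimately have "(\<lambda>n. real (d (g n)) / real b ^ Suc (g n)) sums \<zeta>
      \<longleftrightarrow> (\<lambda>i. real (d i) / real b ^ Suc i) sums \<zeta>"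
    by (rule sums_mono_reindex)
  moreover have "(\<lambda>n. real (d (g n)) / real b ^ Suc (g n)) sums \<zeta>"
  proof -
    have "d (g n) = 1" for n by (simp add: d_def Suc_g)
    then show ?thesis
      using summable_sums[OF summable_digits] by (simp add: Suc_g \<zeta>_def del: power_Suc)
  qed
  ultimately have "(\<lambda>i. real (d i) / real b ^ Suc i) sums \<zeta>" by blast
  moreover have "\<forall>i. d i \<in> {0, 1}" by (simp add: d_def)
  ultimately show ?thesis
    unfolding digits01_set_def using \<zeta>_bounds by auto
qed

definition vec :: "nat \<Rightarrow> nat \<Rightarrow> int" where
  "vec n = (\<lambda>j\<in>{1..k}. int (num n ^ j * b ^ ((k - j) * a n)))"

lemma Q_z_power: "j \<le> k \<Longrightarrow> real (Q (a n)) * z n ^ j = real_of_int (int (num n ^ j * b ^ ((k - j) * a n)))"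
proof -
  assume j: "j \<le> k"
  have "k * a n = (k - j) * a n + a n * j" using j by (simp add: algebra_simps flip: distrib_left)
  then have "real (Q (a n)) = real b ^ ((k - j) * a n) * (real b ^ a n) ^ j"
    by (simp add: Q_def power_add flip: power_mult)
  then show ?thesis using b by (simp add: z_eq power_divide)
qed

lemma approx_error_le:
  "\<bar>\<zeta> ^ j * real (Q (a n)) - real (Q (a n)) * z n ^ j\<bar> \<le> real (Q (a n)) * (\<zeta> - z n)"
proof -
  have "z n ^ j \<le> \<zeta> ^ j" using z_less_\<zeta>[of n] z_nonneg by (intro power_mono) auto
  then have "\<bar>\<zeta> ^ j - z n ^ j\<bar> \<le> \<zeta> - z n"
    using power_diff_le_diff[of "z n" \<zeta> j] z_nonneg[of n] z_less_\<zeta>[of n] \<zeta>_bounds by linarith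
  then have "real (Q (a n)) * \<bar>\<zeta> ^ j - z n ^ j\<bar> \<le> real (Q (a n)) * (\<zeta> - z n)"
    by (intro mult_left_mono) auto
  moreover have "\<bar>\<zeta> ^ j * real (Q (a n)) - real (Q (a n)) * z n ^ j\<bar> = real (Q (a n)) * \<bar>\<zeta> ^ j - z n ^ j\<bar>"
    by (metis abs_mult abs_of_nat mult.commute right_diff_distrib)
  ultimately show ?thesis by simp
qed

lemma strict_mono_Q_a: "strict_mono (\<lambda>n. Q (a n))"
  unfolding strict_mono_Suc_iff Q_def using a_strict b k by auto

lemma infinite_approximations: "infinite (approx_vectors k \<phi> \<zeta> \<inter> primitive_vectors k)"
proof -
  let ?f = "\<lambda>m. (Q (a (2 * m)), vec (2 * m))"
  have "?f m \<in> approx_vectors k \<phi> \<zeta>" for m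
  proof -
    let ?n = "2 * m"
    have "\<bar>\<zeta> ^ j * real (Q (a ?n)) - real_of_int (vec ?n j)\<bar> \<le> \<phi> (Q (a ?n))" if "j \<in> {1..k}" for j
    proof -
      have "real_of_int (vec ?n j) = real (Q (a ?n)) * z ?n ^ j"
        using Q_z_power[of j ?n] that by (simp add: vec_def)
      then show ?thesis
        using approx_error_le[of j ?n] error_le[of ?n] by (simp add: shift_def)
    qed
    moreover have "vec ?n \<in> {1..k} \<rightarrow>\<^sub>E UNIV" unfolding vec_def by auto
    ultimately show ?thesis
      using k Q_pos by (subst mem_approx_vectors_iff) auto
  qed
  moreover have "?f m \<in> primitive_vectors k" for m
  proof -
    let ?n = "2 * m" and ?G = "Gcd (insert (int (Q (a (2 * m)))) (vec (2 * m) ` {1..k}))"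
    \<comment> \<open>The last coordinate is \<open>num ?n ^ k\<close>, without a power of
      \<open>b\<close>, hence coprime to \<open>Q (a ?n)\<close>.\<close>
    have "?G dvd vec ?n k" using k by (intro Gcd_dvd) auto
    then have "?G dvd int (num ?n ^ k)" using k by (simp add: vec_def)
    moreover have "?G dvd int (Q (a ?n))" by (intro Gcd_dvd) auto
    moreover have "coprime (int (num ?n ^ k)) (int (Q (a ?n)))"
    proof -
      have "coprime (num ?n ^ k) ((b ^ a ?n) ^ k)" using coprime_num[of ?n]
        using coprime_power_left_iff coprime_power_right_iff by blast
      then show ?thesis by (simp add: Q_def mult.commute flip: power_mult of_nat_power)
    qed
    ultimately have "is_unit ?G" by (meson coprime_common_divisor)
    then have "?G = 1" by (metis Gcd_int_greater_eq_0 zdvd1_eq abs_of_nonneg)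
    then show ?thesis unfolding primitive_vectors_def by simp
  qed
  ultimately have "range ?f \<subseteq> approx_vectors k \<phi> \<zeta> \<inter> primitive_vectors k" by blast
  moreover have "inj ?f"
    using strict_mono_eq[OF strict_mono_Q_a] by (auto simp: inj_on_def)
  ultimately show ?thesis using infinite_super range_inj_infinite by blast
qed

text \<open>The criterion is applied along even indices, where no shift spoils the upper bound for
  the error.\<close>

lemma \<zeta>_non_algebraic: "\<zeta> \<in> non_algebraic k"
proof (rule non_algebraicI)
  let ?n = "\<lambda>m. 2 * m :: nat"
  show "inj (\<lambda>m. z (?n m))"
    using strict_mono_eq[OF strict_mono_z] by (auto simp: inj_on_def)
  show "Q (a (?n m)) > 0" for m using Q_pos[of "a (?n m)"] by linarith
  show "(\<lambda>m. 1 / real (Q (a (?n m)))) \<longlonglongrightarrow> 0"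
  proof (rule LIMSEQ_I)
    fix r :: real
    assume "r > 0"
    then obtain N where N: "1 / real (Suc N) < r" using nat_approx_posE by blast
    have "1 / real (Q (a (?n m))) < r" if "m \<ge> N" for m
    proof -
      have "2 * m \<le> Q (a (?n m))" by (rule strict_mono_imp_increasing[OF strict_mono_Q_a])
      then have "Suc N \<le> Q (a (?n m))" using that Q_pos[of "a (?n m)"] by linarith
      then have "1 / real (Q (a (?n m))) \<le> 1 / real (Suc N)" by (intro divide_left_mono) auto
      then show ?thesis using N by linarith
    qed
    then show "\<exists>N. \<forall>m\<ge>N. norm (1 / real (Q (a (?n m))) - 0) < r" by auto
  qed
  show "real (Q (a (?n m))) * z (?n m) ^ j \<in> \<int>" if "j \<le> k" for m j
    using Q_z_power[OF that] by (metis Ints_of_int)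
  show "\<bar>\<zeta> ^ j * real (Q (a (?n m))) - real (Q (a (?n m))) * z (?n m) ^ j\<bar> \<le> 1 / real (Q (a (?n m)))"
    for m j
  proof -
    have "\<bar>\<zeta> ^ j * real (Q (a (?n m))) - real (Q (a (?n m))) * z (?n m) ^ j\<bar> \<le> \<phi> (Q (a (?n m)))"
      using approx_error_le[of j "?n m"] error_le[of "?n m"] by (simp add: shift_def)
    also have "\<dots> \<le> 1 / (2 * real (Q (a (?n m))))" by (rule \<phi>_le[OF Q_pos])
    also have "\<dots> \<le> 1 / real (Q (a (?n m)))" using Q_pos[of "a (?n m)"] by (simp add: field_simps)
    finally show ?thesis .
  qed
qed

section \<open>Exclusion of better approximations\<close>

text \<open>Take \<open>n\<close> with \<open>b ^ a n \<le> s ^ 3 < b ^ a (Suc n)\<close>. Distinct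
  fractions \<open>r / s\<close> and \<open>z n\<close> are at least
  \<open>1 / (s * b ^ a n)\<close> apart, but both are closer to \<open>\<zeta>\<close> than half of
  that. Equal fractions in lowest terms have equal denominators.\<close>

lemma good_rational_is_partial_sum:
  fixes r :: int and s :: nat
  assumes s: "s \<ge> 1" and cop: "coprime r (int s)" and close: "\<bar>\<zeta> - of_int r / real s\<bar> \<le> 1 / (4 * real s ^ 4)"
  obtains n where "s = b ^ a n" "of_int r / real s = z n"
proof -
  define n where "n = (LEAST n. s ^ 3 < b ^ a (Suc n))"
  have ex: "\<exists>n. s ^ 3 < b ^ a (Suc n)"
  proof -
    have "s ^ 3 \<le> a (Suc (s ^ 3))"
      using strict_mono_imp_increasing[OF strict_mono_a, of "Suc (s ^ 3)"] by linarith
    also have "\<dots> < b ^ a (Suc (s ^ 3))" using b by (intro power_gt_expt) auto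
    finally show ?thesis by blast
  qed
  have upper: "s ^ 3 < b ^ a (Suc n)"
    unfolding n_def using ex by (rule LeastI_ex)
  have lower: "b ^ a n \<le> s ^ 3"
  proof (cases n)
    case 0
    then show ?thesis using s by simp
  next
    case (Suc m)
    then have "m < (LEAST n. s ^ 3 < b ^ a (Suc n))" by (simp add: n_def)
    then have "\<not> s ^ 3 < b ^ a (Suc m)" by (rule not_less_Least)
    then show ?thesis using Suc by simp
  qed
  define T where "T = real b ^ a n"
  define B where "B = real b ^ a (Suc n)"
  have T: "T \<ge> 1" using b by (simp add: T_def)
  have B: "B \<ge> 64" unfolding B_def by (rule b_pow_a_Suc_ge)
  have sr: "real s \<ge> 1" using s by simp
  have TB: "T ^ 4 \<le> B"
    unfolding T_def B_def using b a_growth[of n]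
    by (simp add: power_increasing mult.commute flip: power_mult)
  have sB: "real s ^ 3 < B"
    using upper unfolding B_def by (simp flip: of_nat_power)
  have Ts: "T \<le> real s ^ 3"
    using lower unfolding T_def by (simp flip: of_nat_power)
  \<comment> \<open>The larger of \<open>s\<close> and \<open>T\<close> decides: with
    \<open>s ^ 3 < B\<close> the constant is absorbed by \<open>B \<ge> 64 = 4 ^ 3\<close>, with
    \<open>T ^ 4 \<le> B\<close> already by \<open>B \<ge> 16 = 4 ^ 2\<close>.\<close>
  have sTB: "4 * (real s * T) \<le> B"
  proof (cases "T \<le> real s")
    case True
    have "(4 * real s ^ 2) ^ 3 = 64 * (real s ^ 3) ^ 2" by (simp add: power_mult_distrib flip: power_mult)
    also have "\<dots> \<le> B * B ^ 2" using sB B by (intro mult_mono power_mono) auto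
    also have "\<dots> = B ^ 3" by (simp add: power2_eq_square power3_eq_cube)
    finally have "4 * real s ^ 2 \<le> B" using B by (subst (asm) power_mono_iff) auto
    moreover have "real s * T \<le> real s ^ 2" using True by (simp add: power2_eq_square mult_left_mono)
    ultimately show ?thesis by linarith
  next
    case False
    have "(4 * T ^ 2) ^ 2 = 16 * T ^ 4" by (simp add: power_mult_distrib flip: power_mult)
    also have "\<dots> \<le> B * B" using TB B by (intro mult_mono) auto
    also have "\<dots> = B ^ 2" by (simp add: power2_eq_square)
    finally have "4 * T ^ 2 \<le> B" by (rule power2_le_imp_le) (use B in simp)
    moreover have "real s * T \<le> T ^ 2" using False T by (simp add: power2_eq_square mult_right_mono)
    ultimately show ?thesis by linarith
  qed
  have eq: "r * int (b ^ a n) = int (num n) * int s"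
  proof (rule ccontr)
    assume ne: "\<not> ?thesis"
    define W where "W = 1 / (real s * T)"
    have "of_int r / real s - z n = of_int (r * int (b ^ a n) - int (num n) * int s) / (real s * T)"
      using sr T by (simp add: z_eq T_def field_simps)
    moreover have "1 \<le> \<bar>of_int (r * int (b ^ a n) - int (num n) * int s) :: real\<bar>" using ne by linarith
    ultimately have far: "W \<le> \<bar>of_int r / real s - z n\<bar>"
      using sr T by (simp add: W_def abs_mult divide_right_mono)
    have "\<zeta> - z n < 2 / B"
    proof -
      have "(1 + \<epsilon>) / B < 2 / B" using \<epsilon>(2) B by (intro divide_strict_right_mono) auto
      then show ?thesis using error_upper[of n] unfolding B_def by linarith
    qed
    moreover have "2 / B \<le> W / 2"
      unfolding W_def using sTB B sr T by (simp add: field_simps)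
    ultimately have near: "\<bar>\<zeta> - z n\<bar> < W / 2"
      using z_less_\<zeta>[of n] by linarith
    have "1 / (4 * real s ^ 4) \<le> W / 4"
    proof -
      have "real s * T \<le> real s * real s ^ 3" using Ts by (intro mult_left_mono) auto
      then have "4 * (real s * T) \<le> 4 * real s ^ 4" by (simp add: power4_eq_xxxx power3_eq_cube mult_ac)
      then have "1 / (4 * real s ^ 4) \<le> 1 / (4 * (real s * T))" using sr T by (intro frac_le) auto
      then show ?thesis by (simp add: W_def)
    qed
    then have "\<bar>\<zeta> - of_int r / real s\<bar> \<le> W / 4" using close by (rule order_trans[rotated])
    moreover have "W > 0" unfolding W_def using sr T by simp
    moreover have "\<bar>X - Z\<bar> \<le> \<bar>Y - X\<bar> + \<bar>Y - Z\<bar>" for X Y Z :: real by linarith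
    from this[of "of_int r / real s" "z n" \<zeta>] have
      "\<bar>of_int r / real s - z n\<bar> \<le> \<bar>\<zeta> - of_int r / real s\<bar> + \<bar>\<zeta> - z n\<bar>" .
    ultimately show False using far near by linarith
  qed
  have "int s dvd r * int (b ^ a n)" "int (b ^ a n) dvd int (num n) * int s" using eq by (metis dvd_triv_right)+
  moreover have "coprime (int s) r" "coprime (int (b ^ a n)) (int (num n))"
    using cop coprime_num[of n] by (simp_all add: coprime_commute del: of_nat_power)
  ultimately have "int s dvd int (b ^ a n)" "int (b ^ a n) dvd int s"
    by (simp_all add: coprime_dvd_mult_right_iff del: of_nat_power)
  then have "s = b ^ a n" unfolding int_dvd_int_iff by (rule dvd_antisym)
  moreover have "of_int r / real s = z n"
  proof -
    have "r = int (num n)" using eq \<open>s = b ^ a n\<close> b by simp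
    then show ?thesis using \<open>s = b ^ a n\<close> by (simp add: z_eq)
  qed
  ultimately show thesis using that by blast
qed

text \<open>The final bound comes from the first coordinate alone: \<open>p 1 / q = z n\<close>, so
  its error is \<open>q * (\<zeta> - z n)\<close>.\<close>

lemma approximation_is_multiple:
  assumes "(q, p) \<in> approx_vectors k (\<lambda>x. c * \<phi> x) \<zeta>"
  obtains n t where "q = t * Q (a n)" "\<And>j. j \<in> {1..k} \<Longrightarrow> int t dvd p j"
    "real t * (real (Q (a n)) * (\<zeta> - z n)) \<le> c * \<phi> q"
proof -
  have q: "q \<ge> 1" and approx: "\<And>j. j \<in> {1..k} \<Longrightarrow> \<bar>\<zeta> ^ j * real q - real_of_int (p j)\<bar> \<le> c * \<phi> q"
    using assms k by (auto simp: mem_approx_vectors_iff)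
  \<comment> \<open>\<open>c \<le> 1 / 2\<close> turns the bound on \<open>\<phi> q\<close> into the
    \<open>1 / (4 * q)\<close> required for lying on the curve.\<close>
  have "c * \<phi> q \<le> 1 / 2 * (1 / (2 * real q))"
    using c_bounds \<phi>_le[OF q] \<phi>_pos[OF q] by (intro mult_mono) auto
  then have \<eta>: "c * \<phi> q \<le> 1 / (4 * real q)" by simp
  have k1: "1 \<le> k" using k by simp
  obtain s r t where s: "s \<ge> 1" and cop: "coprime r (int s)" and qt: "q = s ^ k * t"
    and pj: "\<And>j. j \<in> {1..k} \<Longrightarrow> p j = int t * int s ^ (k - j) * r ^ j"
    by (rule approx_on_veronese_curve[OF less_imp_le[OF \<zeta>_bounds(1)] \<zeta>_bounds(2) q k1 \<eta>])
      (erule approx, blast)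
  have sk: "int s ^ k = int s * int s ^ (k - 1)"
    using power_Suc[of "int s" "k - 1"] k by simp
  have p1t: "p 1 = int t * int s ^ (k - 1) * r" using pj[of 1] k1 by simp
  have q_int: "int q = int s * int s ^ (k - 1) * int t" unfolding qt using sk by simp
  have "p 1 * int s = int q * r" unfolding p1t q_int by (simp add: mult_ac)
  then have "real_of_int (p 1 * int s) = real_of_int (int q * r)" by (rule arg_cong)
  then have "real_of_int (p 1) * real s = real q * of_int r" by simp
  then have p1: "real_of_int (p 1) = real q * (of_int r / real s)" using s by (simp add: field_simps)
  have "\<zeta> * real q - real_of_int (p 1) = real q * (\<zeta> - of_int r / real s)"
    unfolding p1 by (simp add: algebra_simps)
  then have err: "real q * \<bar>\<zeta> - of_int r / real s\<bar> \<le> c * \<phi> q"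
    using approx[of 1] k by (simp add: abs_mult)
  have "\<bar>\<zeta> - of_int r / real s\<bar> \<le> 1 / (4 * real s ^ 4)"
  proof -
    have "t \<ge> 1" using q qt by (cases t) auto
    \<comment> \<open>Here \<open>k \<ge> 2\<close> enters: \<open>s ^ 2 \<le> q\<close>, and the
      error of \<open>r / s\<close> is at most \<open>1 / (4 * q ^ 2)\<close>, which gives the
      fourth power of \<open>s\<close>.\<close>
    then have "s ^ 2 * 1 \<le> s ^ k * t" using s k by (intro mult_mono power_increasing) auto
    then have "s ^ 2 \<le> q" using qt by simp
    then have sq: "real s ^ 2 \<le> real q" by (simp flip: of_nat_power)
    have "real q * \<bar>\<zeta> - of_int r / real s\<bar> \<le> 1 / (4 * real q)" using err \<eta> by linarith
    then have "\<bar>\<zeta> - of_int r / real s\<bar> \<le> 1 / (4 * (real q * real q))" using q by (simp add: field_simps)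
    also have "\<dots> \<le> 1 / (4 * (real s ^ 2 * real s ^ 2))"
      using sq s by (intro frac_le mult_left_mono mult_mono) auto
    finally show ?thesis by (simp flip: power_add)
  qed
  then obtain n where n: "s = b ^ a n" "of_int r / real s = z n"
    using good_rational_is_partial_sum[OF s cop] by blast
  have qQ: "q = t * Q (a n)" using qt n by (simp add: Q_def mult.commute flip: power_mult)
  show thesis
  proof (rule that)
    show "q = t * Q (a n)" by (rule qQ)
    show "int t dvd p j" if "j \<in> {1..k}" for j using pj[OF that] by simp
    show "real t * (real (Q (a n)) * (\<zeta> - z n)) \<le> c * \<phi> q"
      using err z_less_\<zeta>[of n] by (simp add: n(2) qQ mult.assoc)
  qed
qed

text \<open>The multiplier \<open>t\<close> divides every entry, so primitivity leaves
  \<open>t = 1\<close>, against \<open>error_gt\<close>.\<close>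

lemma no_primitive_approximation: "approx_vectors k (\<lambda>x. c * \<phi> x) \<zeta> \<inter> primitive_vectors k = {}"
proof -
  have False if ap: "(q, p) \<in> approx_vectors k (\<lambda>x. c * \<phi> x) \<zeta>" and prim: "(q, p) \<in> primitive_vectors k" for q p
  proof -
    obtain n t where qt: "q = t * Q (a n)" and dvd: "\<And>j. j \<in> {1..k} \<Longrightarrow> int t dvd p j"
      and le: "real t * (real (Q (a n)) * (\<zeta> - z n)) \<le> c * \<phi> q"
      using approximation_is_multiple[OF ap] by blast
    have "int t dvd Gcd (insert (int q) (p ` {1..k}))"
      using qt dvd by (intro Gcd_greatest) auto
    also have "\<dots> = 1" using prim by (simp add: primitive_vectors_def)
    finally have "t = 1" by simp
    then show False using le qt error_gt[of n] by simp
  qed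
  then show ?thesis by auto
qed

text \<open>Passing from \<open>Q (a n)\<close> to \<open>t * Q (a n)\<close> multiplies the error
  by \<open>t\<close> and, by \<open>scale\<close>, the value of \<open>\<phi>\<close> by at most
  \<open>t\<close>, so \<open>error_gt\<close> excludes multiples too.\<close>

lemma no_approximation:
  assumes scale: "\<And>l x. l \<ge> 1 \<Longrightarrow> x \<ge> 1 \<Longrightarrow> \<phi> (l * x) \<le> real l * \<phi> x"
  shows "approx_vectors k (\<lambda>x. c * \<phi> x) \<zeta> = {}"
proof -
  have False if ap: "(q, p) \<in> approx_vectors k (\<lambda>x. c * \<phi> x) \<zeta>" for q p
  proof -
    obtain n t where qt: "q = t * Q (a n)"
      and le: "real t * (real (Q (a n)) * (\<zeta> - z n)) \<le> c * \<phi> q"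
      using approximation_is_multiple[OF ap] by blast
    have "q \<ge> 1" using ap k by (simp add: mem_approx_vectors_iff)
    then have t: "t \<ge> 1" using qt by (cases t) auto
    have "c * \<phi> q \<le> c * (real t * \<phi> (Q (a n)))"
      unfolding qt using c_bounds scale[OF t Q_pos] by (intro mult_left_mono) auto
    also have "\<dots> = real t * (c * \<phi> (Q (a n)))" by simp
    also have "\<dots> < real t * (real (Q (a n)) * (\<zeta> - z n))"
      using error_gt[of n] t by (intro mult_strict_left_mono) auto
    finally show False using le by simp
  qed
  then show ?thesis by auto
qed

section \<open>Recovering \<open>S\<close> from the number, and uncountability\<close>

text \<open>The ranges from \<open>1 / b ^ A\<close> to \<open>(1 + \<epsilon>) / b ^ A\<close> are
  disjoint for different \<open>A\<close>, because
  \<open>1 + \<epsilon> < 2 \<le> b\<close>.\<close>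

lemma a_Suc_determined:
  assumes "1 / real b ^ A \<le> \<zeta> - z n" "\<zeta> - z n \<le> (1 + \<epsilon>) / real b ^ A"
  shows "a (Suc n) = A"
proof -
  have less: "B \<le> A" if "1 / real b ^ A \<le> x" "x \<le> (1 + \<epsilon>) / real b ^ B" for A B x
  proof (rule ccontr)
    assume "\<not> B \<le> A"
    then have "real b ^ Suc A \<le> real b ^ B" using b by (intro power_increasing) auto
    moreover have "2 * real b ^ A \<le> real b ^ Suc A" using b by simp
    ultimately have "2 * real b ^ A \<le> real b ^ B" by linarith
    moreover have "1 / real b ^ A \<le> (1 + \<epsilon>) / real b ^ B" using that by linarith
    then have "real b ^ B \<le> (1 + \<epsilon>) * real b ^ A" using b_pow_pos by (simp add: field_simps)
    moreover have "(1 + \<epsilon>) * real b ^ A < 2 * real b ^ A"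
      using \<epsilon> b_pow_pos by (intro mult_strict_right_mono) auto
    ultimately show False by linarith
  qed
  show ?thesis
    using less[OF assms(1) error_upper] less[OF error_lower assms(2)] by (rule antisym)
qed

end

text \<open>Exponents are recovered one by one: equal partial sums leave equal errors, whose size
  fixes the next exponent. Then the shift at index \<open>2 * m + 1\<close> reveals whether
  \<open>m\<close> is in the set.\<close>

lemma inj_digit_construction:
  assumes "digit_construction k b \<phi> \<epsilon>"
  shows "inj (digit_construction.\<zeta> k b \<phi> \<epsilon>)"
proof (rule injI)
  fix S T
  assume eq: "digit_construction.\<zeta> k b \<phi> \<epsilon> S = digit_construction.\<zeta> k b \<phi> \<epsilon> T"
  interpret s: digit_construction k b \<phi> \<epsilon> S by (rule assms)
  interpret t: digit_construction k b \<phi> \<epsilon> T by (rule assms)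
  have a_eq: "s.a n = t.a n" for n
  proof (induction n rule: less_induct)
    case (less n)
    show ?case
    proof (cases n)
      case (Suc m)
      have "s.z m = t.z m"
        unfolding s.z_def t.z_def using less Suc by (intro sum.cong) auto
      then show ?thesis
        using s.a_Suc_determined[of "t.a (Suc m)" m] t.error_lower[of m] t.error_upper[of m] eq Suc
        by simp
    qed simp
  qed
  have "m \<in> S \<longleftrightarrow> m \<in> T" for m
  proof -
    let ?n = "2 * m + 1"
    have "s.next_pos (s.a ?n) - s.shift ?n = s.next_pos (s.a ?n) - t.shift ?n"
      using a_eq[of "Suc ?n"] a_eq[of ?n] by (simp only: s.a.simps t.a.simps)
    \<comment> \<open>The truncated subtraction can be cancelled: the shifts are at most
      \<open>1\<close> and \<open>next_pos\<close> is at least \<open>1\<close>.\<close>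
    moreover have "s.next_pos (s.a ?n) \<ge> 1" by (rule s.next_pos_ge_1)
    moreover have "s.shift ?n \<le> 1" "t.shift ?n \<le> 1" by (simp_all add: s.shift_def t.shift_def)
    ultimately have "s.shift ?n = t.shift ?n" by linarith
    then show ?thesis by (simp add: s.shift_def t.shift_def split: if_splits)
  qed
  then show "S = T" by blast
qed

text \<open>Sets \<open>S\<close> inject into the target, so Cantor's theorem applies.
  \<open>V\<close> is meant as all vectors or the primitive ones; \<open>C\<close> may lie below
  \<open>c\<close>, even be negative, since a smaller multiple of \<open>\<Psi>\<close> admits fewer
  vectors for large \<open>q\<close>.\<close>

lemma uncountable_digit_construction:
  fixes \<phi> \<Psi> :: "nat \<Rightarrow> real" and C :: real
  assumes D: "digit_construction k b \<phi> \<epsilon>" and ev: "\<forall>\<^sub>F x in sequentially. \<phi> x = \<Psi> x"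
    and C: "C \<le> digit_construction.c b \<epsilon>"
    and inf: "\<And>S. infinite (approx_vectors k \<phi> (digit_construction.\<zeta> k b \<phi> \<epsilon> S) \<inter> V)"
    and none: "\<And>S. approx_vectors k (\<lambda>x. digit_construction.c b \<epsilon> * \<phi> x)
      (digit_construction.\<zeta> k b \<phi> \<epsilon> S) \<inter> V = {}"
  shows "uncountable (({\<zeta> \<in> non_algebraic k. infinite (approx_vectors k \<Psi> \<zeta> \<inter> V)}
    - {\<zeta> \<in> non_algebraic k. infinite (approx_vectors k (\<lambda>x. C * \<Psi> x) \<zeta> \<inter> V)}) \<inter> digits01_set b)"
    (is "uncountable ?X")
proof
  assume "countable ?X"
  let ?\<zeta> = "digit_construction.\<zeta> k b \<phi> \<epsilon>"
  have k1: "k \<ge> 1" using digit_construction.k[OF D] by simp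
  have mem: "?\<zeta> S \<in> ?X" for S
  proof -
    interpret digit_construction k b \<phi> \<epsilon> S by (rule D)
    have "\<forall>\<^sub>F x in sequentially. \<phi> x \<le> \<Psi> x" using ev by (rule eventually_mono) simp
    then have "infinite (approx_vectors k \<Psi> \<zeta> \<inter> V)"
      using inf by (rule infinite_approx_vectors_eventually_le[OF k1])
    moreover have "\<not> infinite (approx_vectors k (\<lambda>x. C * \<Psi> x) \<zeta> \<inter> V)"
    proof
      assume *: "infinite (approx_vectors k (\<lambda>x. C * \<Psi> x) \<zeta> \<inter> V)"
      have "\<forall>\<^sub>F x in sequentially. C * \<Psi> x \<le> c * \<phi> x"
        using ev eventually_ge_at_top[of 1]
      proof eventually_elim
        case (elim x)
        then show ?case using C \<phi>_pos[of x] by (auto intro: mult_right_mono)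
      qed
      then have "infinite (approx_vectors k (\<lambda>x. c * \<phi> x) \<zeta> \<inter> V)"
        using * by (rule infinite_approx_vectors_eventually_le[OF k1])
      then show False using none by simp
    qed
    ultimately show ?thesis using \<zeta>_non_algebraic \<zeta>_in_digits01_set by blast
  qed
  have "countable (range ?\<zeta>)"
    using mem \<open>countable ?X\<close> by (intro countable_subset[of "range ?\<zeta>" ?X]) blast+
  then have "countable (UNIV :: nat set set)"
    using inj_digit_construction[OF D] countable_image_inj_eq by blast
  then obtain f :: "nat \<Rightarrow> nat set" where "range f = UNIV"
    using uncountable_def[of "UNIV :: nat set set"] by auto
  then show False using Cantors_theorem[of "UNIV :: nat set"] by (auto simp: Pow_UNIV)
qed

section \<open>Truncation and conclusion\<close>

text \<open>Truncating \<open>\<Psi>\<close> changes finitely many values and preserves \<open>\<Psi> (l x) \<le> l \<Psi> x\<close>, so the bounds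
  needed by the construction may be assumed from \<open>x = 1\<close> on.\<close>

lemma truncation_suitable:
  fixes k b :: nat and \<Psi> :: "nat \<Rightarrow> real" and C :: real
  assumes "k \<ge> 2" and b: "b \<ge> 2"
    and pos: "\<And>x. x \<ge> 1 \<Longrightarrow> \<Psi> x > 0"
    and ev: "\<forall>\<^sub>F x in sequentially. \<Psi> x < 1 / 2 * inverse (real x)"
    and C: "C < 1 / real b"
  obtains \<phi> \<epsilon> where "digit_construction k b \<phi> \<epsilon>" "\<forall>\<^sub>F x in sequentially. \<phi> x = \<Psi> x"
    "C \<le> digit_construction.c b \<epsilon>"
    "\<And>l x. \<lbrakk>l \<ge> 1; x \<ge> 1; \<Psi> (l * x) \<le> real l * \<Psi> x\<rbrakk> \<Longrightarrow> \<phi> (l * x) \<le> real l * \<phi> x"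
proof -
  \<comment> \<open>The maximum replaces a small or nonpositive \<open>C\<close> by a constant with
    \<open>b * C' \<ge> 2 / 3\<close>, so that \<open>\<epsilon> \<le> 1 / 2\<close>;
    \<open>\<epsilon>\<close> solves \<open>1 / (b * (1 + \<epsilon>)) = C'\<close>.\<close>
  define C' where "C' = max C (2 / (3 * real b))"
  define \<epsilon> where "\<epsilon> = 1 / (real b * C') - 1"
  define \<gamma> where "\<gamma> = min (1 / 64) (\<epsilon> / 2)"
  define \<phi> where "\<phi> x = min (\<Psi> x) (min (1 / (2 * real x)) \<gamma>)" for x
  have b0: "real b > 0" using b by simp
  have C'_lower: "2 / (3 * real b) \<le> C'" and C'_ge: "C \<le> C'" by (simp_all add: C'_def)
  have C'_less: "C' < 1 / real b"
    unfolding C'_def using C b0 by (simp add: field_simps)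
  have bC: "2 / 3 \<le> real b * C'" "real b * C' < 1"
    using C'_lower C'_less b0 by (simp_all add: field_simps)
  have \<epsilon>: "0 < \<epsilon>" "\<epsilon> < 1" using bC by (simp_all add: \<epsilon>_def field_simps)
  have "0 < \<gamma>" using \<epsilon> by (simp add: \<gamma>_def)
  have dc: "digit_construction k b \<phi> \<epsilon>"
  proof
    show "\<phi> x > 0" if "x \<ge> 1" for x using pos[OF that] that \<open>0 < \<gamma>\<close> by (simp add: \<phi>_def)
  qed (use assms \<epsilon> in \<open>auto simp: \<phi>_def \<gamma>_def min_le_iff_disj\<close>)
  show thesis
  proof (rule that[OF dc])
    have "(\<lambda>x. 1 / (2 * real x)) \<longlonglongrightarrow> 0"
      using tendsto_mult_right_zero[OF lim_inverse_n, of "1 / 2"] by (simp add: field_simps)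
    then have "\<forall>\<^sub>F x in sequentially. 1 / (2 * real x) < \<gamma>"
      using \<open>0 < \<gamma>\<close> by (rule order_tendstoD)
    with ev show "\<forall>\<^sub>F x in sequentially. \<phi> x = \<Psi> x"
      by eventually_elim (simp add: \<phi>_def field_simps min_def)
    have "1 + \<epsilon> = 1 / (real b * C')" by (simp add: \<epsilon>_def)
    then have "digit_construction.c b \<epsilon> = C'"
      using b0 bC by (simp add: digit_construction.c_def[OF dc])
    then show "C \<le> digit_construction.c b \<epsilon>" using C'_ge by simp
    fix l x :: nat
    assume l: "l \<ge> 1" and x: "x \<ge> 1" and scale: "\<Psi> (l * x) \<le> real l * \<Psi> x"
    \<comment> \<open>Each of the three terms of the minimum satisfies the scaling inequality, hence
      so does \<open>\<phi>\<close>.\<close>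
    have "1 / (2 * real (l * x)) \<le> real l * (1 / (2 * real x))"
    proof -
      have "1 / (2 * real (l * x)) \<le> 1 / (2 * real x)" using l x by (intro frac_le) auto
      also have "\<dots> \<le> real l * (1 / (2 * real x))" using l mult_right_mono[of 1 "real l" "1 / (2 * real x)"] by simp
      finally show ?thesis .
    qed
    moreover have "\<gamma> \<le> real l * \<gamma>" using l \<open>0 < \<gamma>\<close> by simp
    moreover have "real l * \<phi> x = min (real l * \<Psi> x) (min (real l * (1 / (2 * real x))) (real l * \<gamma>))"
      unfolding \<phi>_def by (simp only: min_mult_distrib_left of_nat_0_le_iff if_True)
    ultimately show "\<phi> (l * x) \<le> real l * \<phi> x"
      using scale unfolding \<phi>_def[of "l * x"] by (simp only: min.mono)
  qed
qed

theorem theorem2p8: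
  fixes k b :: nat and \<Psi> :: "nat \<Rightarrow> real"
  assumes "k \<ge> 2" and "b \<ge> 2"
    and "\<And>x. x \<ge> 1 \<Longrightarrow> \<Psi> x > 0"
    and "\<forall>\<^sub>F x in sequentially. \<Psi> x < 1 / 2 * inverse (real x)"
  shows "((\<forall>l\<ge>1. \<forall>x\<ge>1. \<Psi> (l * x) \<le> real l * \<Psi> x) \<longrightarrow>
           (\<forall>c::real. c < 1 / real b \<longrightarrow>
             uncountable ((approximable k \<Psi> - approximable k (\<lambda>x. c * \<Psi> x)) \<inter> digits01_set b)))
       \<and> (\<forall>c::real. c < 1 / real b \<longrightarrow>
             uncountable ((approximable_prim k \<Psi> - approximable_prim k (\<lambda>x. c * \<Psi> x)) \<inter> digits01_set b))"
proof (intro conjI impI allI)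
  fix c :: real
  assume scale: "\<forall>l\<ge>1. \<forall>x\<ge>1. \<Psi> (l * x) \<le> real l * \<Psi> x" and c: "c < 1 / real b"
  obtain \<phi> \<epsilon> where dc: "digit_construction k b \<phi> \<epsilon>" and ev: "\<forall>\<^sub>F x in sequentially. \<phi> x = \<Psi> x"
    and le: "c \<le> digit_construction.c b \<epsilon>"
    and scale': "\<And>l x. \<lbrakk>l \<ge> 1; x \<ge> 1; \<Psi> (l * x) \<le> real l * \<Psi> x\<rbrakk> \<Longrightarrow> \<phi> (l * x) \<le> real l * \<phi> x"
    using truncation_suitable[OF assms c] by blast
  let ?\<zeta> = "digit_construction.\<zeta> k b \<phi> \<epsilon>"
  have "infinite (approx_vectors k \<phi> (?\<zeta> S) \<inter> UNIV)" for S
    using digit_construction.infinite_approximations[OF dc, of S] by (rule infinite_super[rotated]) blast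
  moreover have "approx_vectors k (\<lambda>x. digit_construction.c b \<epsilon> * \<phi> x) (?\<zeta> S) \<inter> UNIV = {}" for S
  proof -
    have "approx_vectors k (\<lambda>x. digit_construction.c b \<epsilon> * \<phi> x) (?\<zeta> S) = {}"
      by (rule digit_construction.no_approximation[OF dc]) (use scale scale' in blast)
    then show ?thesis by (rule ssubst) simp
  qed
  ultimately have "uncountable (({\<zeta> \<in> non_algebraic k. infinite (approx_vectors k \<Psi> \<zeta> \<inter> UNIV)}
    - {\<zeta> \<in> non_algebraic k. infinite (approx_vectors k (\<lambda>x. c * \<Psi> x) \<zeta> \<inter> UNIV)}) \<inter> digits01_set b)"
    by (rule uncountable_digit_construction[OF dc ev le])
  then show "uncountable ((approximable k \<Psi> - approximable k (\<lambda>x. c * \<Psi> x)) \<inter> digits01_set b)"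
    unfolding approximable_def Int_UNIV_right .
next
  fix c :: real
  assume c: "c < 1 / real b"
  obtain \<phi> \<epsilon> where dc: "digit_construction k b \<phi> \<epsilon>" and ev: "\<forall>\<^sub>F x in sequentially. \<phi> x = \<Psi> x"
    and le: "c \<le> digit_construction.c b \<epsilon>"
    by (rule truncation_suitable[OF assms c])
  show "uncountable ((approximable_prim k \<Psi> - approximable_prim k (\<lambda>x. c * \<Psi> x)) \<inter> digits01_set b)"
    unfolding approximable_prim_def
    by (rule uncountable_digit_construction[OF dc ev le
          digit_construction.infinite_approximations[OF dc]
          digit_construction.no_primitive_approximation[OF dc]])
qed

end
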